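(* For every integer $n\geq 0$, $7\mid MO(3,7n+3)$ and $7\mid MO(3,7n+5)$.
   Context: For $t\geq 1$, the integers $MO(t,n)$ are defined by the formal power series $$U_t(q)=\sum_{n\geq0}MO(t,n)\,q^n=\sum_{1\leq k_1<k_2<\cdots<k_t}\frac{q^{k_1+k_2+\cdots+k_t}}{(1-q^{k_1})^2(1-q^{k_2})^2\cdots(1-q^{k_t})^2}.$$ *)

theory Defs
  imports "HOL-Analysis.Infinite_Sum"
begin

text \<open>
  An index tuple \<open>1 \<le> k\<^sub>1 < \<dots> < k\<^sub>t\<close> is represented by the set \<open>K\<close> of its entries.
  Since \<open>int\<close> is not a field, \<open>1 / f\<close> is written \<open>fps_right_inverse f 1\<close>, the
  inverse of a series with constant coefficient 1
  (see \<open>MO_denominator_inverse\<close> below).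
\<close>

definition MO_index :: "nat \<Rightarrow> nat set set" where
  "MO_index t = {K. K \<subseteq> {1..} \<and> finite K \<and> card K = t}"

definition MO_denominator :: "nat set \<Rightarrow> int fps" where
  "MO_denominator K = (\<Prod>k\<in>K. (1 - fps_X ^ k)\<^sup>2)"

definition MO_summand :: "nat set \<Rightarrow> int fps" where
  "MO_summand K = fps_X ^ (\<Sum>k\<in>K. k) * fps_right_inverse (MO_denominator K) 1"

definition U :: "nat \<Rightarrow> int fps" where
  "U t = (\<Sum>\<^sub>\<infinity>K\<in>MO_index t. MO_summand K)"

definition MO :: "nat \<Rightarrow> nat \<Rightarrow> int" where
  "MO t n = fps_nth (U t) n"

lemma MO_denominator_inverse:
  assumes "K \<in> MO_index t"
  shows "MO_denominator K * fps_right_inverse (MO_denominator K) 1 = 1"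
proof (rule fps_right_inverse)
  have "fps_nth (\<Prod>k\<in>K. (1 - fps_X ^ k)\<^sup>2 :: int fps) 0 = (\<Prod>k\<in>K. fps_nth ((1 - fps_X ^ k)\<^sup>2) 0)"
    by (induction K rule: infinite_finite_induct) (simp_all add: fps_mult_nth)
  also have "\<dots> = (\<Prod>k\<in>K. 1)"
  proof (rule prod.cong)
    fix k assume "k \<in> K"
    then have "k \<noteq> 0" using assms by (force simp: MO_index_def)
    then show "fps_nth ((1 - fps_X ^ k)\<^sup>2 :: int fps) 0 = 1"
      by (simp add: power2_eq_square fps_mult_nth)
  qed simp
  finally show "fps_nth (MO_denominator K) 0 * 1 = 1"
    by (simp add: MO_denominator_def)
qed

text \<open>
  The series converges in the topology of formal power series, so the
  default value of an infinite sum that does not converge plays no role.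
\<close>

lemma U_has_sum: "(MO_summand has_sum U t) (MO_index t)"
proof -
  have fin: "finite {K \<in> MO_index t. fps_nth (MO_summand K) n \<noteq> 0}" for n
  proof (rule finite_subset)
    show "{K \<in> MO_index t. fps_nth (MO_summand K) n \<noteq> 0} \<subseteq> Pow {..n}"
    proof safe
      fix K k assume K: "K \<in> MO_index t" and nz: "fps_nth (MO_summand K) n \<noteq> 0" and k: "k \<in> K"
      have "finite K" using K by (simp add: MO_index_def)
      then have "k \<le> (\<Sum>k\<in>K. k)" using k member_le_sum[of k K "\<lambda>k. k"] by simp
      moreover have "(\<Sum>k\<in>K. k) \<le> n"
        using nz by (auto simp: MO_summand_def fps_X_power_mult_nth split: if_splits)
      ultimately show "k \<le> n" by simp
    qed
  qed simp
  define S where "S = Abs_fps (\<lambda>n. \<Sum>K | K \<in> MO_index t \<and> fps_nth (MO_summand K) n \<noteq> 0.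
    fps_nth (MO_summand K) n)"
  have "(MO_summand has_sum S) (MO_index t)"
    using fin by (rule has_sum_fpsI) (simp add: S_def)
  moreover from this have "U t = S"
    unfolding U_def by (rule infsumI)
  ultimately show ?thesis by simp
qed

end

theory Submission
  imports Defs "HOL-Computational_Algebra.Formal_Laurent_Series"
begin

text \<open>
  The series \<open>U\<^sub>3\<close> is the third elementary symmetric function of the series
  \<open>q\<^sup>k / (1 - q\<^sup>k)\<^sup>2 = \<Sum> m. m (q\<^sup>k)\<^sup>m\<close>. The power sums of these are combinations of the generating functions
  \<open>S\<^sub>1\<close>, \<open>S\<^sub>3\<close>, \<open>S\<^sub>5\<close> of the divisor sums \<open>\<sigma>\<^sub>1\<close>, \<open>\<sigma>\<^sub>3\<close>, \<open>\<sigma>\<^sub>5\<close>, so by Newton's identity \<open>U\<^sub>3\<close> is a combination of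
  \<open>S\<^sub>1\<^sup>3\<close>, \<open>S\<^sub>1\<^sup>2\<close>, \<open>S\<^sub>1 S\<^sub>3\<close> and of \<open>S\<^sub>1\<close>, \<open>S\<^sub>3\<close>, \<open>S\<^sub>5\<close> themselves.

  The products can be removed. Ramanujan's formulas for the derivatives of the Eisenstein series
  \<open>E\<^sub>2\<close> and \<open>E\<^sub>4\<close> express \<open>S\<^sub>1\<^sup>2\<close> and \<open>S\<^sub>1 S\<^sub>3\<close> linearly by the \<open>S\<^sub>k\<close> and the derivatives \<open>D S\<^sub>k\<close>, where
  \<open>D = q d/dq\<close>. Both are the cases \<open>f z = z\<^sup>2\<close> and \<open>f z = z\<^sup>4\<close> of Liouville's identity, which has a
  bijective proof. On coefficients \<open>D\<close> is multiplication by \<open>n\<close>, and the outcome is MacMahon's formula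
  (\<open>MO_3_formula\<close>)
  \<open>1920 MO(3, n) = (40 n\<^sup>2 - 100 n + 37) \<sigma>\<^sub>1(n) - 10 (3 n - 5) \<sigma>\<^sub>3(n) + 3 \<sigma>\<^sub>5(n)\<close>.

  Now 1920 is invertible modulo 7, and \<open>3\<close> and \<open>5\<close> are quadratic non-residues. If \<open>n\<close> is a
  non-residue, the cubes of two complementary divisors of \<open>n\<close> are \<open>1\<close> and \<open>- 1\<close>, so \<open>\<sigma>\<^sub>3(n) = 0\<close>
  modulo 7, and \<open>n d\<^sup>5 = n / d\<close> modulo 7 for every divisor \<open>d\<close>, so \<open>n \<sigma>\<^sub>5(n) = \<sigma>\<^sub>1(n)\<close>
  (\<open>nonresidue_7_divisor_sums\<close>). What remains is a multiple of \<open>\<sigma>\<^sub>5(n)\<close> by a cubic polynomial in \<open>n\<close>,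
  which vanishes modulo 7 at \<open>3\<close> and \<open>5\<close>.
\<close>

section \<open>Liouville's identity\<close>

text \<open>
  The solutions of \<open>a x + b y = n\<close> in positive integers index the terms of a convolution of two
  divisor sums: \<open>a\<close> is a divisor of \<open>i = a x\<close> and \<open>b\<close> a divisor of \<open>n - i = b y\<close>.
\<close>

definition quads :: "nat \<Rightarrow> (nat \<times> nat \<times> nat \<times> nat) set" where
  "quads n = {(a, b, x, y). 0 < a \<and> 0 < b \<and> 0 < x \<and> 0 < y \<and> a * x + b * y = n}"

lemma finite_quads: "finite (quads n)"
proof (rule finite_subset)
  have "a \<le> n \<and> b \<le> n \<and> x \<le> n \<and> y \<le> n" if "(a, b, x, y) \<in> quads n" for a b x y
  proof -
    from that have "0 < a" "0 < b" "0 < x" "0 < y" and "a * x + b * y = n"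
      by (auto simp: quads_def)
    moreover from this have "a \<le> a * x" "x \<le> a * x" "b \<le> b * y" "y \<le> b * y"
      by simp_all
    ultimately show ?thesis by linarith
  qed
  then show "quads n \<subseteq> {..n} \<times> {..n} \<times> {..n} \<times> {..n}"
    by auto
qed simp

lemma sum_quads_split:
  fixes g :: "nat \<times> nat \<times> nat \<times> nat \<Rightarrow> 'a::comm_monoid_add"
  shows "sum g (quads n) =
    sum g {(a, b, x, y) \<in> quads n. P a b x y} + sum g {(a, b, x, y) \<in> quads n. \<not> P a b x y}"
proof -
  have "sum g (quads n) = sum g ({(a, b, x, y) \<in> quads n. P a b x y} \<union> {(a, b, x, y) \<in> quads n. \<not> P a b x y})"
    by (rule sum.cong) auto
  also have "\<dots> = sum g {(a, b, x, y) \<in> quads n. P a b x y} + sum g {(a, b, x, y) \<in> quads n. \<not> P a b x y}"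
    by (rule sum.union_disjoint) (auto intro: finite_subset[OF _ finite_quads])
  finally show ?thesis .
qed

lemma sum_quads_trichotomy:
  fixes g :: "nat \<times> nat \<times> nat \<times> nat \<Rightarrow> 'a::comm_monoid_add"
    and u v :: "nat \<Rightarrow> nat \<Rightarrow> nat \<Rightarrow> nat \<Rightarrow> nat"
  shows "sum g (quads n) =
    sum g {(a, b, x, y) \<in> quads n. u a b x y < v a b x y} +
    sum g {(a, b, x, y) \<in> quads n. u a b x y > v a b x y} +
    sum g {(a, b, x, y) \<in> quads n. u a b x y = v a b x y}"
proof -
  let ?A = "{(a, b, x, y) \<in> quads n. u a b x y < v a b x y}"
  let ?B = "{(a, b, x, y) \<in> quads n. u a b x y > v a b x y}"
  let ?C = "{(a, b, x, y) \<in> quads n. u a b x y = v a b x y}"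
  have fin: "finite ?A" "finite ?B" "finite ?C"
    by (auto intro: finite_subset[OF _ finite_quads])
  have "quads n = ?A \<union> ?B \<union> ?C" by auto
  then have "sum g (quads n) = sum g (?A \<union> ?B \<union> ?C)" by simp
  also have "\<dots> = sum g (?A \<union> ?B) + sum g ?C"
    using fin by (intro sum.union_disjoint) auto
  also have "sum g (?A \<union> ?B) = sum g ?A + sum g ?B"
    using fin by (intro sum.union_disjoint) auto
  finally show ?thesis .
qed

text \<open>
  The identity \<open>a x + b y = (a - b) x + b (x + y)\<close> turns a solution with \<open>b < a\<close> into one
  with \<open>x < y\<close>, and this step can be undone.
\<close>

lemma sum_quads_shear:
  fixes g :: "nat \<Rightarrow> nat \<Rightarrow> 'a::comm_monoid_add"
  shows "(\<Sum>(a, b, x, y) \<in> {(a, b, x, y) \<in> quads n. b < a}. g a b) =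
    (\<Sum>(a, b, x, y) \<in> {(a, b, x, y) \<in> quads n. x < y}. g (a + b) b)"
  by (rule sum.reindex_bij_witness[where
        i = "\<lambda>(a, b, x, y). (a + b, b, x, y - x)" and j = "\<lambda>(a, b, x, y). (a - b, b, x, x + y)"])
    (auto simp: quads_def algebra_simps dest!: less_imp_Suc_add)

lemma sum_quads_swap_terms:
  fixes g :: "nat \<Rightarrow> nat \<Rightarrow> nat \<Rightarrow> nat \<Rightarrow> 'a::comm_monoid_add"
  shows "(\<Sum>(a, b, x, y) \<in> {(a, b, x, y) \<in> quads n. P a b x y}. g a b x y) =
    (\<Sum>(a, b, x, y) \<in> {(a, b, x, y) \<in> quads n. P b a y x}. g b a y x)"
  by (rule sum.reindex_bij_witness[where
        i = "\<lambda>(a, b, x, y). (b, a, y, x)" and j = "\<lambda>(a, b, x, y). (b, a, y, x)"])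
    (auto simp: quads_def algebra_simps)

lemma sum_quads_swap_factors:
  fixes g :: "nat \<Rightarrow> nat \<Rightarrow> nat \<Rightarrow> nat \<Rightarrow> 'a::comm_monoid_add"
  shows "(\<Sum>(a, b, x, y) \<in> {(a, b, x, y) \<in> quads n. P a b x y}. g a b x y) =
    (\<Sum>(a, b, x, y) \<in> {(a, b, x, y) \<in> quads n. P a y x b}. g a y x b)"
  by (rule sum.reindex_bij_witness[where
        i = "\<lambda>(a, b, x, y). (a, y, x, b)" and j = "\<lambda>(a, b, x, y). (a, y, x, b)"])
    (auto simp: quads_def algebra_simps)

lemma sum_divisors_flip:
  fixes g :: "nat \<Rightarrow> nat \<Rightarrow> 'a::comm_monoid_add"
  assumes "0 < n"
  shows "(\<Sum>d | d dvd n. g d (n div d)) = (\<Sum>d | d dvd n. g (n div d) d)"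
  by (rule sum.reindex_bij_witness[where i = "\<lambda>d. n div d" and j = "\<lambda>d. n div d"])
    (use assms in \<open>auto elim!: dvdE\<close>)

text \<open>
  Here \<open>(a + b) x = n\<close>, so such a solution is a divisor \<open>d = a + b\<close> of \<open>n\<close> together with a way to
  split \<open>d\<close> into two positive parts.
\<close>

lemma sum_quads_equal_factors:
  fixes g :: "nat \<Rightarrow> nat \<Rightarrow> 'a::comm_monoid_add"
  assumes "0 < n"
  shows "(\<Sum>(a, b, x, y) \<in> {(a, b, x, y) \<in> quads n. x = y}. g a b) =
    (\<Sum>d | d dvd n. \<Sum>a\<in>{1..<d}. g a (d - a))"
proof -
  have "(\<Sum>d | d dvd n. \<Sum>a\<in>{1..<d}. g a (d - a)) =
      (\<Sum>(d, a)\<in>(SIGMA d:{d. d dvd n}. {1..<d}). g a (d - a))"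
    using assms by (intro sum.Sigma) auto
  also have "\<dots> = (\<Sum>(a, b, x, y) \<in> {(a, b, x, y) \<in> quads n. x = y}. g a b)"
    by (rule sum.reindex_bij_witness[where
        i = "\<lambda>(a, b, x, y). (a + b, a)" and j = "\<lambda>(d, a). (a, d - a, n div d, n div d)"])
      (use assms in \<open>auto simp: quads_def simp flip: distrib_right elim!: dvdE\<close>)
  finally show ?thesis ..
qed

text \<open>
  For fixed \<open>a\<close> and \<open>b\<close>, the step \<open>(x, y) \<mapsto> (x - b, y + a)\<close> along the line \<open>a x + b y = n\<close> leads from
  \<open>b < x\<close> to \<open>a < y\<close>. The solutions with \<open>b = x\<close> would end on \<open>x = 0\<close>, hence the boundary term.
\<close>

lemma sum_quads_large_factor:
  fixes g :: "nat \<Rightarrow> 'a::comm_monoid_add"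
  assumes "0 < n"
  shows "(\<Sum>(a, b, x, y) \<in> {(a, b, x, y) \<in> quads n. b \<le> x}. g a) =
    (\<Sum>(a, b, x, y) \<in> {(a, b, x, y) \<in> quads n. a < y}. g a) + (\<Sum>d | d dvd n. \<Sum>a\<in>{1..<d}. g a)"
proof -
  let ?A = "{(a, b, x, y) \<in> quads n. b < x}"
  let ?B = "{(a, b, x, y) \<in> quads n. b = x}"
  have fin: "finite ?A" "finite ?B"
    by (auto intro: finite_subset[OF _ finite_quads])
  have "{(a, b, x, y) \<in> quads n. b \<le> x} = ?A \<union> ?B" by auto
  then have "(\<Sum>(a, b, x, y) \<in> {(a, b, x, y) \<in> quads n. b \<le> x}. g a) =
      (\<Sum>(a, b, x, y) \<in> ?A. g a) + (\<Sum>(a, b, x, y) \<in> ?B. g a)"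
    using fin by (simp only:) (intro sum.union_disjoint; auto)
  also have "(\<Sum>(a, b, x, y) \<in> ?A. g a) = (\<Sum>(a, b, x, y) \<in> {(a, b, x, y) \<in> quads n. a < y}. g a)"
    by (rule sum.reindex_bij_witness[where
        i = "\<lambda>(a, b, x, y). (a, b, x + b, y - a)" and j = "\<lambda>(a, b, x, y). (a, b, x - b, y + a)"])
      (auto simp: quads_def algebra_simps dest!: less_imp_Suc_add)
  also have "(\<Sum>(a, b, x, y) \<in> ?B. g a) = (\<Sum>(a, b, x, y) \<in> {(a, b, x, y) \<in> quads n. x = y}. g a)"
    by (subst sum_quads_swap_factors) (simp add: eq_commute)
  also have "\<dots> = (\<Sum>d | d dvd n. \<Sum>a\<in>{1..<d}. g a)"
    using assms by (rule sum_quads_equal_factors)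
  finally show ?thesis .
qed

text \<open>
  Exchanging \<open>b\<close> with \<open>y\<close> makes \<open>x < y\<close> into \<open>x < b\<close>, the complement of the condition of
  \<open>sum_quads_large_factor\<close>; the same exchange makes the condition \<open>a < y\<close> obtained there into \<open>a < b\<close>.
  So the sum over \<open>x < y\<close> is the whole sum without the part \<open>a < b\<close> and without the boundary term,
  and the parts \<open>b < a\<close> and \<open>a = b\<close> are left.
\<close>

lemma sum_quads_trade:
  fixes g :: "nat \<Rightarrow> 'a::ab_group_add"
  assumes "0 < n"
  shows "(\<Sum>(a, b, x, y) \<in> {(a, b, x, y) \<in> quads n. x < y}. g a) -
      (\<Sum>(a, b, x, y) \<in> {(a, b, x, y) \<in> quads n. b < a}. g a) =
    (\<Sum>(a, b, x, y) \<in> {(a, b, x, y) \<in> quads n. a = b}. g a) -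
      (\<Sum>d | d dvd n. \<Sum>a\<in>{1..<d}. g a)"
proof -
  define G where "G = (\<lambda>(a :: nat, b :: nat, x :: nat, y :: nat). g a)"
  have "sum G (quads n) =
      sum G {(a, b, x, y) \<in> quads n. b \<le> x} + sum G {(a, b, x, y) \<in> quads n. \<not> b \<le> x}"
    by (rule sum_quads_split)
  also have "sum G {(a, b, x, y) \<in> quads n. \<not> b \<le> x} = sum G {(a, b, x, y) \<in> quads n. x < y}"
    unfolding G_def not_le by (rule sum_quads_swap_factors)
  also have "sum G {(a, b, x, y) \<in> quads n. b \<le> x} =
      sum G {(a, b, x, y) \<in> quads n. a < y} + (\<Sum>d | d dvd n. \<Sum>a\<in>{1..<d}. g a)"
    unfolding G_def using assms by (rule sum_quads_large_factor)
  also have "sum G {(a, b, x, y) \<in> quads n. a < y} = sum G {(a, b, x, y) \<in> quads n. a < b}"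
    unfolding G_def by (rule sum_quads_swap_factors)
  finally show ?thesis
    using sum_quads_trichotomy[of G n "\<lambda>a b x y. a" "\<lambda>a b x y. b"]
    unfolding G_def[symmetric] by (simp add: algebra_simps)
qed

text \<open>
  Because \<open>f\<close> is even, the terms \<open>f (a - b)\<close> with \<open>a < b\<close> and with \<open>b < a\<close> have the same sum, and the
  shear \<open>sum_quads_shear\<close> writes it as the sum of \<open>f a\<close> over \<open>x < y\<close>. The shear read backwards
  writes the sum of \<open>f (a + b)\<close> over \<open>x < y\<close>, and by symmetry over \<open>y < x\<close>, as the sum of \<open>f a\<close> over
  \<open>b < a\<close>. The two resulting sums of \<open>f a\<close> differ only by the divisor sums of \<open>sum_quads_trade\<close>, and
  the diagonals \<open>a = b\<close> and \<open>x = y\<close> are divisor sums as well.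
\<close>

theorem Liouville_identity:
  fixes f :: "int \<Rightarrow> 'a::comm_ring_1"
  assumes even: "\<And>z. f (- z) = f z" and "0 < n"
  shows "(\<Sum>(a, b, x, y) \<in> quads n. f (int a - int b) - f (int a + int b)) =
    (\<Sum>d | d dvd n. (of_nat d - 1) * f 0 + (2 * of_nat (n div d) - of_nat d - 1) * f (int d)
      - 2 * (\<Sum>a\<in>{1..<d}. f (int a)))"
proof -
  let ?m = "\<lambda>(a, b, x, y). f (int a - int b)"
  let ?p = "\<lambda>(a, b, x, y). f (int a + int b)"
  let ?f = "\<lambda>(a, b, x, y). f (int a)"
  let ?T = "\<Sum>d | d dvd n. \<Sum>a\<in>{1..<d}. f (int a)"
  have minus: "sum ?m (quads n) =
      2 * sum ?f {(a, b, x, y) \<in> quads n. x < y} + (\<Sum>d | d dvd n. (of_nat d - 1) * f 0)"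
  proof -
    have gt: "sum ?m {(a, b, x, y) \<in> quads n. b < a} = sum ?f {(a, b, x, y) \<in> quads n. x < y}"
      using sum_quads_shear[of "\<lambda>a b. f (int a - int b)" n] by simp
    have "sum ?m {(a, b, x, y) \<in> quads n. a < b} =
        (\<Sum>(a, b, x, y) \<in> {(a, b, x, y) \<in> quads n. b < a}. f (int b - int a))"
      by (rule sum_quads_swap_terms)
    also have "\<dots> = sum ?m {(a, b, x, y) \<in> quads n. b < a}"
    proof (rule sum.cong[OF refl], clarify)
      show "f (int b - int a) = f (int a - int b)" for a b
        using even[of "int a - int b"] by simp
    qed
    finally have lt: "sum ?m {(a, b, x, y) \<in> quads n. a < b} = sum ?f {(a, b, x, y) \<in> quads n. x < y}"
      using gt by simp
    have "sum ?m {(a, b, x, y) \<in> quads n. a = b} = (\<Sum>(a, b, x, y) \<in> {(a, b, x, y) \<in> quads n. a = b}. f 0)"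
      by (rule sum.cong) auto
    also have "\<dots> = (\<Sum>(a, b, x, y) \<in> {(a, b, x, y) \<in> quads n. a = y}. f 0)"
      by (rule sum_quads_swap_factors)
    also have "\<dots> = (\<Sum>(a, b, x, y) \<in> {(a, b, x, y) \<in> quads n. x = y}. f 0)"
      by (rule sum.reindex_bij_witness[where
            i = "\<lambda>(a, b, x, y). (x, b, a, y)" and j = "\<lambda>(a, b, x, y). (x, b, a, y)"])
        (auto simp: quads_def algebra_simps)
    also have "\<dots> = (\<Sum>d | d dvd n. \<Sum>a\<in>{1..<d}. f 0)"
      using \<open>0 < n\<close> by (rule sum_quads_equal_factors)
    also have "\<dots> = (\<Sum>d | d dvd n. (of_nat d - 1) * f 0)"
    proof (rule sum.cong[OF refl])
      fix d assume "d \<in> {d. d dvd n}"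
      then have "0 < d" using \<open>0 < n\<close> by (auto intro: Nat.gr0I)
      then show "(\<Sum>a\<in>{1..<d}. f 0) = (of_nat d - 1) * f 0"
        by (simp add: of_nat_diff)
    qed
    finally have "sum ?m {(a, b, x, y) \<in> quads n. a = b} = (\<Sum>d | d dvd n. (of_nat d - 1) * f 0)" .
    then show ?thesis
      using sum_quads_trichotomy[of ?m n "\<lambda>a b x y. a" "\<lambda>a b x y. b"] gt lt by simp
  qed
  have plus: "sum ?p (quads n) =
      2 * sum ?f {(a, b, x, y) \<in> quads n. b < a} + (\<Sum>d | d dvd n. (of_nat d - 1) * f (int d))"
  proof -
    have lt: "sum ?p {(a, b, x, y) \<in> quads n. x < y} = sum ?f {(a, b, x, y) \<in> quads n. b < a}"
      using sum_quads_shear[of "\<lambda>a b. f (int a)" n] by simp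
    have gt: "sum ?p {(a, b, x, y) \<in> quads n. x > y} = sum ?p {(a, b, x, y) \<in> quads n. x < y}"
      by (subst sum_quads_swap_terms) (simp add: add.commute)
    have "sum ?p {(a, b, x, y) \<in> quads n. x = y} =
        (\<Sum>d | d dvd n. \<Sum>a\<in>{1..<d}. f (int a + int (d - a)))"
      using \<open>0 < n\<close> by (rule sum_quads_equal_factors)
    also have "\<dots> = (\<Sum>d | d dvd n. (of_nat d - 1) * f (int d))"
    proof (rule sum.cong[OF refl])
      fix d assume "d \<in> {d. d dvd n}"
      then have "0 < d" using \<open>0 < n\<close> by (auto intro: Nat.gr0I)
      have "(\<Sum>a\<in>{1..<d}. f (int a + int (d - a))) = (\<Sum>a\<in>{1..<d}. f (int d))"
        by (rule sum.cong) (auto simp: of_nat_diff)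
      then show "(\<Sum>a\<in>{1..<d}. f (int a + int (d - a))) = (of_nat d - 1) * f (int d)"
        using \<open>0 < d\<close> by (simp add: of_nat_diff)
    qed
    finally show ?thesis
      using sum_quads_trichotomy[of ?p n "\<lambda>a b x y. x" "\<lambda>a b x y. y"] lt gt by simp
  qed
  have diag: "sum ?f {(a, b, x, y) \<in> quads n. a = b} =
      (\<Sum>d | d dvd n. (of_nat (n div d) - 1) * f (int d))"
  proof -
    have "sum ?f {(a, b, x, y) \<in> quads n. a = b} =
        (\<Sum>(a, b, x, y) \<in> {(a, b, x, y) \<in> quads n. x = y}. f (int x))"
      by (rule sum.reindex_bij_witness[where
            i = "\<lambda>(a, b, x, y). (x, y, a, b)" and j = "\<lambda>(a, b, x, y). (x, y, a, b)"])
        (auto simp: quads_def algebra_simps)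
    also have "\<dots> = (\<Sum>(a, b, x, y) \<in> {(a, b, x, y) \<in> quads n. x = y}. f (int (n div (a + b))))"
      by (rule sum.cong) (auto simp: quads_def simp flip: distrib_right)
    also have "\<dots> = (\<Sum>d | d dvd n. \<Sum>a\<in>{1..<d}. f (int (n div (a + (d - a)))))"
      using \<open>0 < n\<close> by (rule sum_quads_equal_factors)
    also have "\<dots> = (\<Sum>d | d dvd n. (of_nat d - 1) * f (int (n div d)))"
    proof (rule sum.cong[OF refl])
      fix d assume "d \<in> {d. d dvd n}"
      then have "0 < d" using \<open>0 < n\<close> by (auto intro: Nat.gr0I)
      then show "(\<Sum>a\<in>{1..<d}. f (int (n div (a + (d - a))))) = (of_nat d - 1) * f (int (n div d))"
        by (simp add: of_nat_diff)
    qed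
    also have "\<dots> = (\<Sum>d | d dvd n. (of_nat (n div d) - 1) * f (int d))"
      using \<open>0 < n\<close> by (rule sum_divisors_flip)
    finally show ?thesis .
  qed
  have "(\<Sum>(a, b, x, y) \<in> quads n. f (int a - int b) - f (int a + int b)) =
      sum ?m (quads n) - sum ?p (quads n)"
    by (simp add: sum_subtractf[symmetric] case_prod_unfold)
  also have "\<dots> = 2 * (sum ?f {(a, b, x, y) \<in> quads n. x < y} - sum ?f {(a, b, x, y) \<in> quads n. b < a})
      + (\<Sum>d | d dvd n. (of_nat d - 1) * f 0) - (\<Sum>d | d dvd n. (of_nat d - 1) * f (int d))"
    by (simp add: minus plus algebra_simps)
  also have "sum ?f {(a, b, x, y) \<in> quads n. x < y} - sum ?f {(a, b, x, y) \<in> quads n. b < a} =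
      (\<Sum>d | d dvd n. (of_nat (n div d) - 1) * f (int d)) - ?T"
    using sum_quads_trade[OF \<open>0 < n\<close>, of "\<lambda>a. f (int a)"] diag by simp
  finally have "(\<Sum>(a, b, x, y) \<in> quads n. f (int a - int b) - f (int a + int b)) =
      2 * ((\<Sum>d | d dvd n. (of_nat (n div d) - 1) * f (int d)) - ?T)
      + (\<Sum>d | d dvd n. (of_nat d - 1) * f 0) - (\<Sum>d | d dvd n. (of_nat d - 1) * f (int d))" .
  then show ?thesis
    unfolding sum_distrib_left sum_subtractf[symmetric] sum.distrib[symmetric]
    by (simp add: algebra_simps sum_distrib_left)
qed

section \<open>Convolutions of divisor sums\<close>

text \<open>
  The value at \<open>0\<close> is \<open>0\<close>, as \<open>0\<close> has infinitely many divisors; this makes it the right constant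
  coefficient of the generating function \<open>\<Sum> n \<ge> 1. \<sigma>\<^sub>k(n) q\<^sup>n\<close>.
\<close>

definition divisor_sum :: "nat \<Rightarrow> nat \<Rightarrow> int" where
  "divisor_sum k n = (\<Sum>d | d dvd n. int d ^ k)"

definition divisor_series :: "nat \<Rightarrow> int fps" where
  "divisor_series k = Abs_fps (divisor_sum k)"

lemma divisor_series_nth [simp]: "fps_nth (divisor_series k) n = divisor_sum k n"
  by (simp add: divisor_series_def)

lemma divisor_sum_0 [simp]: "divisor_sum k 0 = 0"
  by (simp add: divisor_sum_def)

lemma divisor_series_mult_nth:
  "fps_nth (divisor_series j * divisor_series k) n = (\<Sum>(a, b, x, y) \<in> quads n. int a ^ j * int b ^ k)"
proof -
  have "fps_nth (divisor_series j * divisor_series k) n =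
      (\<Sum>i=0..n. divisor_sum j i * divisor_sum k (n - i))"
    by (simp add: fps_mult_nth divisor_series_def)
  also have "\<dots> = (\<Sum>i\<in>{0<..<n}. divisor_sum j i * divisor_sum k (n - i))"
    by (rule sum.mono_neutral_right) (auto simp: Suc_le_eq intro: ccontr)
  also have "\<dots> = (\<Sum>i\<in>{0<..<n}. \<Sum>(a, b)\<in>{a. a dvd i} \<times> {b. b dvd n - i}. int a ^ j * int b ^ k)"
    by (simp add: divisor_sum_def sum_product sum.cartesian_product)
  also have "\<dots> = (\<Sum>(i, a, b)\<in>(SIGMA i:{0<..<n}. {a. a dvd i} \<times> {b. b dvd n - i}). int a ^ j * int b ^ k)"
    by (subst sum.Sigma) (auto simp: case_prod_unfold)
  also have "\<dots> = (\<Sum>(a, b, x, y) \<in> quads n. int a ^ j * int b ^ k)"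
    by (rule sum.reindex_bij_witness[where
        i = "\<lambda>(a, b, x, y). (a * x, a, b)" and j = "\<lambda>(i, a, b). (a, b, i div a, (n - i) div b)"])
      (auto simp: quads_def dvd_div_eq_0_iff intro!: Nat.gr0I)
  finally show ?thesis .
qed

lemma sum_int_powers_2: "6 * (\<Sum>a\<in>{1..<d}. int a ^ 2) = 2 * int d ^ 3 - 3 * int d ^ 2 + int d"
  by (induction d) (auto simp: sum.atLeastLessThan_Suc algebra_simps power2_eq_square power3_eq_cube)

lemma sum_int_powers_4:
  "30 * (\<Sum>a\<in>{1..<d}. int a ^ 4) = 6 * int d ^ 5 - 15 * int d ^ 4 + 10 * int d ^ 3 - int d"
  by (induction d) (auto simp: sum.atLeastLessThan_Suc algebra_simps eval_nat_numeral)

definition X_deriv :: "'a::comm_ring_1 fps \<Rightarrow> 'a fps" where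
  "X_deriv f = fps_X * fps_deriv f"

lemma X_deriv_nth [simp]: "fps_nth (X_deriv f) n = of_nat n * fps_nth f n"
  by (cases n) (auto simp: X_deriv_def)

lemma X_deriv_add: "X_deriv (f + g) = X_deriv f + X_deriv g"
  by (simp add: X_deriv_def algebra_simps)

lemma X_deriv_diff: "X_deriv (f - g) = X_deriv f - X_deriv g"
  by (simp add: X_deriv_def algebra_simps)

lemma X_deriv_mult: "X_deriv (f * g) = X_deriv f * g + f * X_deriv g"
  by (simp add: X_deriv_def algebra_simps)

lemma X_deriv_numeral: "X_deriv (numeral k) = 0"
  by (simp add: X_deriv_def)

lemmas X_deriv_simps = X_deriv_add X_deriv_diff X_deriv_mult X_deriv_numeral

lemma fps_numeral_mult_nth:
  "fps_nth (numeral k * f) n = numeral k * fps_nth (f :: 'a::comm_ring_1 fps) n"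
  by (simp add: numeral_fps_const)

text \<open>
  Ramanujan's formula for the derivative of the Eisenstein series \<open>E\<^sub>2\<close>, in the form of a convolution
  formula for \<open>\<sigma>\<^sub>1 * \<sigma>\<^sub>1\<close>. It is Liouville's identity for \<open>f z = z\<^sup>2\<close>, as
  \<open>(a - b)\<^sup>2 - (a + b)\<^sup>2 = - 4 a b\<close>.
\<close>

lemma divisor_series_1_squared:
  "12 * divisor_series 1 ^ 2 = 5 * divisor_series 3 - 6 * X_deriv (divisor_series 1) + divisor_series 1"
proof (rule fps_ext)
  fix n
  show "fps_nth (12 * divisor_series 1 ^ 2) n =
    fps_nth (5 * divisor_series 3 - 6 * X_deriv (divisor_series 1) + divisor_series 1) n"
  proof (cases "n = 0")
    case True
    then show ?thesis by (simp add: power2_eq_square)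
  next
    case False
    have "-12 * (\<Sum>(a, b, x, y) \<in> quads n. int a ^ 1 * int b ^ 1) =
       3 * (\<Sum>(a, b, x, y) \<in> quads n. (int a - int b) ^ 2 - (int a + int b) ^ 2)"
      by (simp add: sum_distrib_left case_prod_unfold algebra_simps power2_eq_square)
    also have "\<dots> = 3 * (\<Sum>d | d dvd n. (int d - 1) * 0 ^ 2 + (2 * int (n div d) - int d - 1) * int d ^ 2
         - 2 * (\<Sum>a\<in>{1..<d}. int a ^ 2))"
      using Liouville_identity[of "\<lambda>z. z ^ 2" n] False by simp
    also have "\<dots> = (\<Sum>d | d dvd n. 6 * int n * int d ^ 1 - 5 * int d ^ 3 - int d ^ 1)"
    proof (subst sum_distrib_left, rule sum.cong[OF refl])
      fix d assume "d \<in> {d. d dvd n}"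
      then have n: "int n = int d * int (n div d)" by (metis dvd_mult_div_cancel mem_Collect_eq of_nat_mult)
      show "3 * ((int d - 1) * 0 ^ 2 + (2 * int (n div d) - int d - 1) * int d ^ 2
         - 2 * (\<Sum>a\<in>{1..<d}. int a ^ 2)) = 6 * int n * int d ^ 1 - 5 * int d ^ 3 - int d ^ 1"
        using sum_int_powers_2[of d]
        by (simp add: n algebra_simps power2_eq_square power3_eq_cube)
    qed
    also have "\<dots> = 6 * int n * divisor_sum 1 n - 5 * divisor_sum 3 n - divisor_sum 1 n"
      by (simp add: divisor_sum_def sum_subtractf sum_distrib_left)
    finally show ?thesis
      using divisor_series_mult_nth[of 1 1 n]
      by (simp add: power2_eq_square fps_numeral_mult_nth)
  qed
qed

text \<open>
  Ramanujan's formula for the derivative of \<open>E\<^sub>4\<close>, which is Liouville's identity for \<open>f z = z\<^sup>4\<close>, as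
  \<open>(a - b)\<^sup>4 - (a + b)\<^sup>4 = - 8 (a b\<^sup>3 + a\<^sup>3 b)\<close>.
\<close>

lemma divisor_series_1_times_3:
  "240 * (divisor_series 1 * divisor_series 3) = 21 * divisor_series 5 - 30 * X_deriv (divisor_series 3)
    + 10 * divisor_series 3 - divisor_series 1"
proof (rule fps_ext)
  fix n
  show "fps_nth (240 * (divisor_series 1 * divisor_series 3)) n =
    fps_nth (21 * divisor_series 5 - 30 * X_deriv (divisor_series 3)
      + 10 * divisor_series 3 - divisor_series 1) n"
  proof (cases "n = 0")
    case True
    then show ?thesis by simp
  next
    case False
    have "-240 * (\<Sum>(a, b, x, y) \<in> quads n. int a ^ 1 * int b ^ 3) =
      -120 * (\<Sum>(a, b, x, y) \<in> quads n. int a ^ 1 * int b ^ 3)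
      - 120 * (\<Sum>(a, b, x, y) \<in> quads n. int a ^ 3 * int b ^ 1)"
      using divisor_series_mult_nth[of 1 3 n] divisor_series_mult_nth[of 3 1 n]
      by (simp add: mult.commute)
    also have "\<dots> =
       15 * (\<Sum>(a, b, x, y) \<in> quads n. (int a - int b) ^ 4 - (int a + int b) ^ 4)"
      unfolding sum_distrib_left sum_subtractf[symmetric]
      by (rule sum.cong) (auto simp: algebra_simps eval_nat_numeral)
    also have "\<dots> = 15 * (\<Sum>d | d dvd n. (int d - 1) * 0 ^ 4 + (2 * int (n div d) - int d - 1) * int d ^ 4
         - 2 * (\<Sum>a\<in>{1..<d}. int a ^ 4))"
      using Liouville_identity[of "\<lambda>z. z ^ 4" n] False by simp
    also have "\<dots> = (\<Sum>d | d dvd n. 30 * int n * int d ^ 3 - 21 * int d ^ 5 - 10 * int d ^ 3 + int d ^ 1)"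
    proof (subst sum_distrib_left, rule sum.cong[OF refl])
      fix d assume "d \<in> {d. d dvd n}"
      then have n: "int n = int d * int (n div d)" by (metis dvd_mult_div_cancel mem_Collect_eq of_nat_mult)
      show "15 * ((int d - 1) * 0 ^ 4 + (2 * int (n div d) - int d - 1) * int d ^ 4
         - 2 * (\<Sum>a\<in>{1..<d}. int a ^ 4)) = 30 * int n * int d ^ 3 - 21 * int d ^ 5 - 10 * int d ^ 3 + int d ^ 1"
        using sum_int_powers_4[of d]
        by (simp add: n algebra_simps eval_nat_numeral)
    qed
    also have "\<dots> = 30 * int n * divisor_sum 3 n - 21 * divisor_sum 5 n - 10 * divisor_sum 3 n + divisor_sum 1 n"
      by (simp add: divisor_sum_def sum_subtractf sum.distrib sum_distrib_left)
    finally show ?thesis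
      using divisor_series_mult_nth[of 1 3 n]
      by (simp add: fps_numeral_mult_nth)
  qed
qed

section \<open>Elementary symmetric functions\<close>

definition esym :: "nat \<Rightarrow> ('b \<Rightarrow> 'a::comm_ring_1) \<Rightarrow> 'b set \<Rightarrow> 'a" where
  "esym t x A = (\<Sum>K | K \<subseteq> A \<and> card K = t. \<Prod>k\<in>K. x k)"

lemma esym_0: "finite A \<Longrightarrow> esym 0 x A = 1"
proof -
  assume "finite A"
  then have "{K. K \<subseteq> A \<and> card K = 0} = {{}}"
    by (auto dest: finite_subset)
  then show ?thesis by (simp add: esym_def)
qed

lemma esym_empty:
  fixes x :: "'b \<Rightarrow> 'a::comm_ring_1"
  shows "esym (Suc t) x {} = 0"
proof -
  have "{K :: 'b set. K \<subseteq> {} \<and> card K = Suc t} = {}" by auto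
  then show ?thesis by (simp only: esym_def sum.empty)
qed

lemma esym_insert:
  assumes "finite A" and "a \<notin> A"
  shows "esym (Suc t) x (insert a A) = esym (Suc t) x A + x a * esym t x A"
proof -
  let ?B = "{K. K \<subseteq> A \<and> card K = t}"
  have card: "card (insert a K) = Suc (card K)" if "K \<subseteq> A" for K
    using that assms by (metis card_insert_disjoint finite_subset subsetD)
  have split: "{K. K \<subseteq> insert a A \<and> card K = Suc t} = {K. K \<subseteq> A \<and> card K = Suc t} \<union> insert a ` ?B"
  proof (intro equalityI subsetI)
    fix K assume K: "K \<in> {K. K \<subseteq> insert a A \<and> card K = Suc t}"
    show "K \<in> {K. K \<subseteq> A \<and> card K = Suc t} \<union> insert a ` ?B"
    proof (cases "a \<in> K")
      case True
      then have "K = insert a (K - {a})" "K - {a} \<subseteq> A" using K by auto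
      moreover from this have "card (K - {a}) = t" using K card[of "K - {a}"] by auto
      ultimately show ?thesis by blast
    qed (use K in auto)
  qed (auto simp: card)
  have inj: "inj_on (insert a) ?B"
    using assms(2) by (intro inj_onI) (metis (no_types, lifting) insert_ident mem_Collect_eq subsetD)
  have "esym (Suc t) x (insert a A) = esym (Suc t) x A + (\<Sum>K\<in>insert a ` ?B. \<Prod>k\<in>K. x k)"
    unfolding esym_def split using assms by (intro sum.union_disjoint) auto
  also have "(\<Sum>K\<in>insert a ` ?B. \<Prod>k\<in>K. x k) = (\<Sum>K\<in>?B. \<Prod>k\<in>insert a K. x k)"
    by (simp add: sum.reindex[OF inj])
  also have "\<dots> = (\<Sum>K\<in>?B. x a * (\<Prod>k\<in>K. x k))"
    using assms by (intro sum.cong refl prod.insert) (auto dest: finite_subset)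
  also have "\<dots> = x a * esym t x A"
    by (simp add: esym_def sum_distrib_left)
  finally show ?thesis .
qed

lemma esym_3_newton:
  assumes "finite A"
  shows "6 * esym 3 x A = (\<Sum>k\<in>A. x k) ^ 3 - 3 * (\<Sum>k\<in>A. x k) * (\<Sum>k\<in>A. x k ^ 2) + 2 * (\<Sum>k\<in>A. x k ^ 3)"
proof -
  have 1: "esym 1 x A = (\<Sum>k\<in>A. x k)" if "finite A" for A
    using that by induction (simp_all add: esym_empty esym_insert esym_0)
  have 2: "2 * esym 2 x A = (\<Sum>k\<in>A. x k) ^ 2 - (\<Sum>k\<in>A. x k ^ 2)" if "finite A" for A
    using that
  proof induction
    case empty
    show ?case by (simp add: numeral_2_eq_2 esym_empty)
  next
    case (insert a A)
    show ?case using insert 1[OF insert(1)] esym_insert[of A a 1 x]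
      by (simp add: numeral_2_eq_2 algebra_simps)
  qed
  show ?thesis using assms
  proof induction
    case empty
    show ?case by (simp add: numeral_3_eq_3 esym_empty)
  next
    case (insert a A)
    have "6 * esym 3 x (insert a A) = 6 * esym 3 x A + 3 * x a * (2 * esym 2 x A)"
      using insert esym_insert[of A a 2 x] by (simp add: numeral_3_eq_3 numeral_2_eq_2 algebra_simps)
    then show ?case using insert 2[OF insert(1)]
      by (simp add: algebra_simps power2_eq_square power3_eq_cube)
  qed
qed

section \<open>Powers of the series with coefficients 0, 1, 2, ...\<close>

definition id_series :: "int fps" where
  "id_series = Abs_fps int"

lemma id_series_nth [simp]: "fps_nth id_series n = int n"
  by (simp add: id_series_def)

lemma id_series_closed_form: "id_series * (1 - fps_X) ^ 2 = fps_X"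
proof (rule fps_ext)
  fix n
  have "id_series * (1 - fps_X) ^ 2 = id_series - 2 * (fps_X ^ 1 * id_series) + fps_X ^ 2 * id_series"
    by (simp add: power2_eq_square algebra_simps)
  then have "fps_nth (id_series * (1 - fps_X) ^ 2) n =
      int n - 2 * (if n < 1 then 0 else int (n - 1)) + (if n < 2 then 0 else int (n - 2))"
    by (simp only: fps_X_power_mult_nth fps_numeral_mult_nth
        fps_add_nth fps_sub_nth id_series_nth)
  then show "fps_nth (id_series * (1 - fps_X) ^ 2) n = fps_nth fps_X n"
    by (auto simp: fps_X_def)
qed

text \<open>
  With \<open>w = 1 / (1 - X)\<close> and \<open>D = X d/dX\<close> these are the equations \<open>D w = X / (1 - X)\<^sup>2 = w\<^sup>2 - w\<close>.
\<close>

lemma geometric_series_ODE: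
  fixes w :: "int fps"
  defines "w \<equiv> Abs_fps (\<lambda>_. 1)"
  shows "X_deriv w = id_series" and "id_series = w ^ 2 - w"
proof -
  show 1: "X_deriv w = id_series"
    by (rule fps_ext) (simp add: w_def)
  show "id_series = w ^ 2 - w"
    by (rule fps_ext) (simp add: w_def power2_eq_square fps_mult_nth)
qed

text \<open>
  The differential equations of \<open>F = w\<^sup>2 - w\<close> follow from \<open>D w = F\<close>: as \<open>D F = (2 w - 1) F\<close> and
  \<open>(2 w - 1)\<^sup>2 = 4 F + 1\<close>, the even derivatives of \<open>F\<close> are polynomials in \<open>F\<close>. Since \<open>D\<close> multiplies
  the \<open>m\<close>-th coefficient by \<open>m\<close>, the coefficients of \<open>F\<^sup>2\<close> and \<open>F\<^sup>3\<close> can be read off from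
  \<open>D\<^sup>2 F\<close> and \<open>D\<^sup>2 (F\<^sup>2)\<close>.
\<close>

lemma id_series_ODE:
  shows "X_deriv (X_deriv id_series) = id_series + 6 * id_series ^ 2"
    and "X_deriv id_series ^ 2 = id_series ^ 2 * (4 * id_series + 1)"
proof -
  define w :: "int fps" where "w = Abs_fps (\<lambda>_. 1)"
  have w: "X_deriv w = id_series" "id_series = w ^ 2 - w"
    using geometric_series_ODE unfolding w_def by auto
  have 1: "X_deriv id_series = 2 * (w * id_series) - id_series"
  proof -
    have "X_deriv id_series = X_deriv (w * w - w)"
      by (simp only: w(2) power2_eq_square)
    also have "\<dots> = 2 * (w * X_deriv w) - X_deriv w"
      by (simp add: X_deriv_simps)
    finally show ?thesis by (simp only: w(1))
  qed
  have "X_deriv (X_deriv id_series) = X_deriv (2 * (w * id_series) - id_series)"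
    by (simp only: 1)
  also have "\<dots> = 2 * (X_deriv w * id_series + w * X_deriv id_series) - X_deriv id_series"
    by (simp add: X_deriv_simps)
  also have "\<dots> = 2 * id_series ^ 2 + (4 * (w ^ 2 - w) + 1) * id_series"
    unfolding 1 w(1) by (simp add: algebra_simps power2_eq_square)
  also have "\<dots> = id_series + 6 * id_series ^ 2"
    unfolding w(2)[symmetric] by (simp add: algebra_simps power2_eq_square)
  finally show "X_deriv (X_deriv id_series) = id_series + 6 * id_series ^ 2" .
  have "X_deriv id_series ^ 2 = id_series ^ 2 * (4 * (w ^ 2 - w) + 1)"
    unfolding 1 by (simp add: algebra_simps power2_eq_square)
  then show "X_deriv id_series ^ 2 = id_series ^ 2 * (4 * id_series + 1)"
    unfolding w(2)[symmetric] .
qed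

lemma id_series_squared_nth: "6 * fps_nth (id_series ^ 2) m = int m ^ 3 - int m"
proof -
  have "int m * (int m * int m) = int m + 6 * fps_nth (id_series ^ 2) m"
    using arg_cong[OF id_series_ODE(1), of "\<lambda>f. fps_nth f m"]
    by (simp only: X_deriv_nth fps_numeral_mult_nth fps_add_nth id_series_nth)
  then show ?thesis by (simp add: power3_eq_cube algebra_simps)
qed

lemma id_series_cubed_nth:
  "120 * fps_nth (id_series ^ 3) m = int m ^ 5 - 5 * int m ^ 3 + 4 * int m"
proof -
  have "X_deriv (X_deriv (id_series ^ 2)) =
      2 * X_deriv id_series ^ 2 + 2 * (id_series * X_deriv (X_deriv id_series))"
    by (simp add: power2_eq_square X_deriv_simps)
  also have "\<dots> = 4 * id_series ^ 2 + 20 * id_series ^ 3"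
    unfolding id_series_ODE by (simp add: algebra_simps power2_eq_square power3_eq_cube)
  finally have "int m * (int m * fps_nth (id_series ^ 2) m) =
      4 * fps_nth (id_series ^ 2) m + 20 * fps_nth (id_series ^ 3) m"
    by (metis (no_types) X_deriv_nth fps_numeral_mult_nth fps_add_nth)
  then have "int m * (int m * (6 * fps_nth (id_series ^ 2) m)) =
      4 * (6 * fps_nth (id_series ^ 2) m) + 120 * fps_nth (id_series ^ 3) m"
    by simp
  then show ?thesis
    unfolding id_series_squared_nth by (simp add: eval_nat_numeral algebra_simps)
qed

section \<open>The MacMahon series as a symmetric function\<close>

text \<open>
  This is \<open>q\<^sup>k / (1 - q\<^sup>k)\<^sup>2\<close> by \<open>MO_factor_closed_form\<close>; as a composition, the coefficients of its
  powers come directly from those of the powers of \<open>X / (1 - X)\<^sup>2\<close>.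
\<close>

definition MO_factor :: "nat \<Rightarrow> int fps" where
  "MO_factor k = fps_compose id_series (fps_X ^ k)"

lemma MO_factor_closed_form:
  assumes "0 < k"
  shows "MO_factor k * (1 - fps_X ^ k) ^ 2 = fps_X ^ k"
proof -
  have 0: "fps_nth (fps_X ^ k) 0 = (0::int)" using assms by simp
  have "fps_compose (id_series * (1 - fps_X) ^ 2) (fps_X ^ k) = fps_compose fps_X (fps_X ^ k)"
    by (simp only: id_series_closed_form)
  then show ?thesis
    using 0 by (simp add: fps_compose_mult_distrib fps_compose_power[symmetric]
        fps_compose_sub_distrib MO_factor_def del: fps_X_power_nth)
qed

lemma MO_factor_power_nth:
  assumes "0 < k"
  shows "fps_nth (MO_factor k ^ j) n = (if k dvd n then fps_nth (id_series ^ j) (n div k) else 0)"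
proof -
  have 0: "fps_nth (fps_X ^ k) 0 = (0::int)" using assms by simp
  show ?thesis
    using assms
    by (simp add: MO_factor_def fps_nth_compose_X_power fps_compose_power[OF 0])
qed

lemma MO_summand_eq_prod:
  assumes "K \<in> MO_index t"
  shows "MO_summand K = (\<Prod>k\<in>K. MO_factor k)"
proof -
  have pos: "0 < k" if "k \<in> K" for k
    using that assms by (force simp: MO_index_def)
  have "(\<Prod>k\<in>K. MO_factor k) * MO_denominator K = (\<Prod>k\<in>K. fps_X ^ k)"
    unfolding MO_denominator_def prod.distrib[symmetric]
    by (rule prod.cong) (simp_all add: MO_factor_closed_form pos)
  also have "\<dots> = fps_X ^ (\<Sum>k\<in>K. k)"
    by (simp add: power_sum)
  finally have "MO_summand K = (\<Prod>k\<in>K. MO_factor k) *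
      (MO_denominator K * fps_right_inverse (MO_denominator K) 1)"
    by (simp add: MO_summand_def mult.assoc)
  then show ?thesis
    using MO_denominator_inverse[OF assms] by simp
qed

text \<open>
  The summand of \<open>K\<close> is divisible by \<open>q\<^sup>k\<close> for every \<open>k \<in> K\<close>, so that only sets \<open>K\<close> with entries
  at most \<open>n\<close> contribute to the \<open>n\<close>-th coefficient, which is therefore a coefficient of a polynomial
  in finitely many factors.
\<close>

lemma MO_eq_esym_nth: "MO t n = fps_nth (esym t MO_factor {1..n}) n"
proof -
  have nz: "K \<subseteq> {1..i}" if K: "K \<in> MO_index t" and "fps_nth (MO_summand K) i \<noteq> 0" for K i
  proof
    fix k assume "k \<in> K"
    moreover have "finite K" "K \<subseteq> {1..}" using K by (auto simp: MO_index_def)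
    ultimately have "1 \<le> k" "k \<le> (\<Sum>k\<in>K. k)"
      using member_le_sum[of k K "\<lambda>k. k"] by auto
    moreover have "(\<Sum>k\<in>K. k) \<le> i"
      using that(2) by (auto simp: MO_summand_def fps_X_power_mult_nth split: if_splits)
    ultimately show "k \<in> {1..i}" by simp
  qed
  define S where "S = Abs_fps (\<lambda>i. fps_nth (esym t MO_factor {1..i}) i)"
  have "(MO_summand has_sum S) (MO_index t)"
  proof (rule has_sum_fpsI)
    fix i
    have sub: "{K \<in> MO_index t. fps_nth (MO_summand K) i \<noteq> 0} \<subseteq> {K. K \<subseteq> {1..i} \<and> card K = t}"
      using nz by (auto simp: MO_index_def)
    have fin: "finite {K. K \<subseteq> {1..i} \<and> card K = t}"
      by (rule finite_subset[of _ "Pow {1..i}"]) auto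
    show "finite {K \<in> MO_index t. fps_nth (MO_summand K) i \<noteq> 0}"
      using sub fin by (rule finite_subset)
    have index: "K \<in> MO_index t" if "K \<subseteq> {1..i}" "card K = t" for K
      using that by (auto simp: MO_index_def intro: finite_subset)
    have "fps_nth S i = (\<Sum>K | K \<subseteq> {1..i} \<and> card K = t. fps_nth (MO_summand K) i)"
      unfolding S_def esym_def fps_nth_Abs_fps fps_sum_nth
      by (rule sum.cong) (simp_all add: MO_summand_eq_prod[OF index])
    also have "\<dots> = (\<Sum>K | K \<in> MO_index t \<and> fps_nth (MO_summand K) i \<noteq> 0. fps_nth (MO_summand K) i)"
      using index by (intro sum.mono_neutral_right fin sub) blast
    finally show "fps_nth S i = \<dots>" .
  qed
  then have "U t = S"
    unfolding U_def by (rule infsumI)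
  then show ?thesis by (simp add: MO_def S_def)
qed

text \<open>
  The \<open>i\<close>-th coefficient of the \<open>j\<close>-th power sum only sees the \<open>k\<close> that divide \<open>i\<close>; the terms are
  renamed by \<open>d = i / k\<close>.
\<close>

lemma MO_factor_power_sum_nth:
  assumes "i \<le> n" and "fps_nth (id_series ^ j) 0 = 0"
  shows "fps_nth (\<Sum>k\<in>{1..n}. MO_factor k ^ j) i = (\<Sum>d | d dvd i. fps_nth (id_series ^ j) d)"
proof (cases "i = 0")
  case True
  \<comment> \<open>Both sides vanish: a sum over the infinite set of all divisors of \<open>0\<close> is \<open>0\<close>.\<close>
  then show ?thesis using assms(2) by (simp add: fps_sum_nth MO_factor_power_nth)
next
  case False
  have "fps_nth (\<Sum>k\<in>{1..n}. MO_factor k ^ j) i =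
      (\<Sum>k\<in>{1..n}. if k dvd i then fps_nth (id_series ^ j) (i div k) else 0)"
    unfolding fps_sum_nth by (rule sum.cong) (simp_all add: MO_factor_power_nth)
  also have "\<dots> = (\<Sum>k\<in>{k\<in>{1..n}. k dvd i}. fps_nth (id_series ^ j) (i div k))"
    by (rule sum.inter_filter[symmetric]) simp
  also have "{k\<in>{1..n}. k dvd i} = {k. k dvd i}"
    using False assms(1) by (auto simp: Suc_le_eq intro!: Nat.gr0I dest: dvd_imp_le)
  also have "(\<Sum>k | k dvd i. fps_nth (id_series ^ j) (i div k)) = (\<Sum>d | d dvd i. fps_nth (id_series ^ j) d)"
    using sum_divisors_flip[of i "\<lambda>d e. fps_nth (id_series ^ j) e"] False by simp
  finally show ?thesis .
qed

lemma fps_mult_nth_cong: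
  assumes "\<And>i. i \<le> n \<Longrightarrow> fps_nth f i = fps_nth f' i" and "\<And>i. i \<le> n \<Longrightarrow> fps_nth g i = fps_nth g' i"
    and "i \<le> n"
  shows "fps_nth (f * g) i = fps_nth (f' * g') i"
  unfolding fps_mult_nth using assms by (intro sum.cong) auto

section \<open>MacMahon's formula in weight six\<close>

text \<open>
  Newton's identity \<open>6 e\<^sub>3 = p\<^sub>1\<^sup>3 - 3 p\<^sub>1 p\<^sub>2 + 2 p\<^sub>3\<close>, where up to the \<open>n\<close>-th coefficient the power sums are
  \<open>p\<^sub>1 = S\<^sub>1\<close>, \<open>6 p\<^sub>2 = S\<^sub>3 - S\<^sub>1\<close> and \<open>120 p\<^sub>3 = S\<^sub>5 - 5 S\<^sub>3 + 4 S\<^sub>1\<close> with \<open>S\<^sub>k\<close> the generating function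
  of \<open>\<sigma>\<^sub>k\<close>.
\<close>

lemma MO_3_via_products:
  "360 * MO 3 n = fps_nth (60 * divisor_series 1 ^ 3
     - 30 * (divisor_series 1 * (divisor_series 3 - divisor_series 1))
     + (divisor_series 5 - 5 * divisor_series 3 + 4 * divisor_series 1)) n"
proof -
  define p where "p j = (\<Sum>k\<in>{1..n}. MO_factor k ^ j)" for j
  let ?S = "divisor_series"
  have sum_nth: "fps_nth (p j) i = (\<Sum>d | d dvd i. fps_nth (id_series ^ j) d)" if "0 < j" "i \<le> n" for i j
    unfolding p_def using that by (intro MO_factor_power_sum_nth) (simp_all add: fps_nth_power_0)
  have p1: "fps_nth (p 1) i = fps_nth (?S 1) i" if "i \<le> n" for i
    using that by (simp add: sum_nth divisor_sum_def)
  have p2: "fps_nth (6 * p 2) i = fps_nth (?S 3 - ?S 1) i" if "i \<le> n" for i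
    using that by (simp add: sum_nth fps_numeral_mult_nth sum_distrib_left id_series_squared_nth
        divisor_sum_def sum_subtractf)
  have p3: "fps_nth (120 * p 3) i = fps_nth (?S 5 - 5 * ?S 3 + 4 * ?S 1) i" if "i \<le> n" for i
    using that by (simp add: sum_nth fps_numeral_mult_nth sum_distrib_left id_series_cubed_nth
        divisor_sum_def sum_subtractf sum.distrib)
  have "360 * MO 3 n = fps_nth (60 * (6 * esym 3 MO_factor {1..n})) n"
    by (simp add: MO_eq_esym_nth fps_numeral_mult_nth)
  also have "60 * (6 * esym 3 MO_factor {1..n}) =
      60 * (p 1 * (p 1 * p 1)) - 30 * (p 1 * (6 * p 2)) + 120 * p 3"
    unfolding p_def by (subst esym_3_newton) (simp_all add: power3_eq_cube algebra_simps)
  also have "fps_nth \<dots> n = fps_nth (60 * (?S 1 * (?S 1 * ?S 1))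
      - 30 * (?S 1 * (?S 3 - ?S 1)) + (?S 5 - 5 * ?S 3 + 4 * ?S 1)) n"
  proof -
    have nth: "fps_nth (60 * f - 30 * g + h) n = 60 * fps_nth f n - 30 * fps_nth g n + fps_nth h n"
      for f g h :: "int fps"
      by (simp add: fps_numeral_mult_nth)
    have "fps_nth (p 1 * (p 1 * p 1)) n = fps_nth (?S 1 * (?S 1 * ?S 1)) n"
      by (intro fps_mult_nth_cong[of n] p1) auto
    moreover have "fps_nth (p 1 * (6 * p 2)) n = fps_nth (?S 1 * (?S 3 - ?S 1)) n"
      by (intro fps_mult_nth_cong[of n] p1 p2) auto
    ultimately show ?thesis
      by (simp only: nth p3[OF order_refl])
  qed
  finally show ?thesis
    by (simp only: power3_eq_cube mult.assoc)
qed

text \<open>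
  The formula is due to MacMahon. Multiplying the convolution formula for \<open>S\<^sub>1\<^sup>2\<close> by \<open>S\<^sub>1\<close> gives the products
  \<open>S\<^sub>1 S\<^sub>3\<close> and \<open>S\<^sub>1 D S\<^sub>1\<close>; the latter is \<open>D (S\<^sub>1\<^sup>2) / 2\<close>. So \<open>S\<^sub>1\<^sup>3\<close>, and with it the expression of
  \<open>MO_3_via_products\<close>, is linear in \<open>S\<^sub>1\<close>, \<open>S\<^sub>3\<close>, \<open>S\<^sub>5\<close> and their derivatives.
\<close>

theorem MO_3_formula:
  "1920 * MO 3 n = (40 * int n ^ 2 - 100 * int n + 37) * divisor_sum 1 n
     - 10 * (3 * int n - 5) * divisor_sum 3 n + 3 * divisor_sum 5 n"
proof -
  let ?S = "divisor_series"
  have square: "12 * (?S 1 * ?S 1) = 5 * ?S 3 - 6 * X_deriv (?S 1) + ?S 1"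
    using divisor_series_1_squared by (simp only: power2_eq_square)
  have mixed: "24 * (?S 1 * X_deriv (?S 1)) =
      5 * X_deriv (?S 3) - 6 * X_deriv (X_deriv (?S 1)) + X_deriv (?S 1)"
  proof -
    have "24 * (?S 1 * X_deriv (?S 1)) = X_deriv (12 * (?S 1 * ?S 1))"
      by (simp add: X_deriv_simps)
    also have "\<dots> = X_deriv (5 * ?S 3 - 6 * X_deriv (?S 1) + ?S 1)"
      by (simp only: square)
    also have "\<dots> = 5 * X_deriv (?S 3) - 6 * X_deriv (X_deriv (?S 1)) + X_deriv (?S 1)"
      by (simp add: X_deriv_simps)
    finally show ?thesis .
  qed
  have cube: "12 * ?S 1 ^ 3 = 5 * (?S 1 * ?S 3) - 6 * (?S 1 * X_deriv (?S 1)) + ?S 1 * ?S 1"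
  proof -
    have "12 * ?S 1 ^ 3 = ?S 1 * (12 * (?S 1 * ?S 1))"
      by (simp add: power3_eq_cube algebra_simps)
    also have "\<dots> = 5 * (?S 1 * ?S 3) - 6 * (?S 1 * X_deriv (?S 1)) + ?S 1 * ?S 1"
      unfolding square by (simp add: algebra_simps)
    finally show ?thesis .
  qed
  note coeffs = arg_cong[of _ _ "\<lambda>f. fps_nth f n"]
  note nth = fps_add_nth fps_sub_nth fps_numeral_mult_nth X_deriv_nth divisor_series_nth
  show ?thesis
    using MO_3_via_products[of n] coeffs[OF square] coeffs[OF mixed] coeffs[OF cube]
      coeffs[OF divisor_series_1_times_3]
    unfolding right_diff_distrib nth by (simp add: algebra_simps power2_eq_square)
qed

section \<open>Divisor sums at quadratic non-residues modulo 7\<close>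

text \<open>
  If \<open>d e\<close> is a quadratic non-residue mod 7, then \<open>d\<^sup>3\<close> and \<open>e\<^sup>3\<close> are \<open>1\<close> and \<open>- 1\<close> in some order by
  Euler's criterion, and \<open>d e d\<^sup>5 = d\<^sup>6 e\<close> is congruent to \<open>e\<close> by Fermat's theorem. The proof compares
  all residues.
\<close>

lemma nonresidue_7_factors:
  fixes d e :: int
  assumes "(d * e) mod 7 \<in> {3, 5, 6}"
  shows "7 dvd d ^ 3 + e ^ 3" and "7 dvd d * e * d ^ 5 - e"
proof -
  have table: "\<forall>u\<in>{0, 1, 2, 3, 4, 5, 6 :: int}. \<forall>v\<in>{0, 1, 2, 3, 4, 5, 6}. (u * v) mod 7 \<in> {3, 5, 6} \<longrightarrow>
      (u ^ 3 + v ^ 3) mod 7 = 0 \<and> (u * v * u ^ 5 - v) mod 7 = 0"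
    by simp
  have residue: "z mod 7 \<in> {0, 1, 2, 3, 4, 5, 6}" for z :: int
    using pos_mod_bound[of 7 z] pos_mod_sign[of 7 z] by (simp only: insert_iff empty_iff) linarith
  have residues: "((d mod 7) ^ 3 + (e mod 7) ^ 3) mod 7 = 0 \<and>
      ((d mod 7) * (e mod 7) * (d mod 7) ^ 5 - (e mod 7)) mod 7 = 0"
    using table[rule_format, OF residue[of d] residue[of e]] assms by (simp add: mod_mult_eq)
  have "(d ^ 3 + e ^ 3) mod 7 = ((d mod 7) ^ 3 + (e mod 7) ^ 3) mod 7"
    by (intro mod_add_cong) (simp_all add: power_mod)
  also have "\<dots> = 0"
    using residues by (rule conjunct1)
  finally show "7 dvd d ^ 3 + e ^ 3"
    by (simp only: dvd_eq_mod_eq_0)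
  have "(d * e * d ^ 5 - e) mod 7 = ((d mod 7) * (e mod 7) * (d mod 7) ^ 5 - (e mod 7)) mod 7"
    by (intro mod_diff_cong mod_mult_cong) (simp_all add: power_mod)
  also have "\<dots> = 0"
    using residues by (rule conjunct2)
  finally show "7 dvd d * e * d ^ 5 - e"
    by (simp only: dvd_eq_mod_eq_0)
qed

text \<open>
  Pairing each divisor \<open>d\<close> of \<open>n\<close> with \<open>n / d\<close> cancels the sum of cubes, and \<open>n d\<^sup>5\<close> is congruent to the
  complementary divisor \<open>n / d\<close>.
\<close>

lemma nonresidue_7_divisor_sums:
  assumes "int n mod 7 \<in> {3, 5, 6}"
  shows "7 dvd divisor_sum 3 n" and "7 dvd int n * divisor_sum 5 n - divisor_sum 1 n"
proof -
  have "0 < n" using assms by (auto intro: Nat.gr0I)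
  have factors: "7 dvd int d ^ 3 + int (n div d) ^ 3" "7 dvd int n * int d ^ 5 - int (n div d)"
    if "d dvd n" for d
  proof -
    have n: "int d * int (n div d) = int n"
      using that by (metis dvd_mult_div_cancel of_nat_mult)
    show "7 dvd int d ^ 3 + int (n div d) ^ 3"
      by (rule nonresidue_7_factors(1)) (use assms in \<open>simp only: n\<close>)
    have "7 dvd int d * int (n div d) * int d ^ 5 - int (n div d)"
      by (rule nonresidue_7_factors(2)) (use assms in \<open>simp only: n\<close>)
    then show "7 dvd int n * int d ^ 5 - int (n div d)"
      by (simp only: n)
  qed
  have flip: "divisor_sum k n = (\<Sum>d | d dvd n. int (n div d) ^ k)" for k
    unfolding divisor_sum_def using sum_divisors_flip[OF \<open>0 < n\<close>, of "\<lambda>d e. int d ^ k"] .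
  have "7 dvd (\<Sum>d | d dvd n. int d ^ 3 + int (n div d) ^ 3)"
    by (intro dvd_sum) (simp add: factors)
  then have "7 dvd 2 * divisor_sum 3 n"
    using flip[of 3] by (simp add: sum.distrib divisor_sum_def)
  then show "7 dvd divisor_sum 3 n" by presburger
  have "7 dvd (\<Sum>d | d dvd n. int n * int d ^ 5 - int (n div d))"
    by (intro dvd_sum) (simp add: factors)
  then show "7 dvd int n * divisor_sum 5 n - divisor_sum 1 n"
    using flip[of 1] by (simp add: sum_subtractf divisor_sum_def sum_distrib_left)
qed

theorem theorem8p5:
  fixes n :: nat
  shows "7 dvd MO 3 (7 * n + 3) \<and> 7 dvd MO 3 (7 * n + 5)"
proof -
  have "7 dvd MO 3 m" if m: "int m = 7 * q + r" and r: "r = 3 \<or> r = 5" for m q r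
  proof -
    define A where "A = 40 * int m ^ 2 - 100 * int m + 37"
    \<comment> \<open>Given \<open>m \<sigma>\<^sub>5(m) = \<sigma>\<^sub>1(m)\<close> mod 7, this is the factor of \<open>\<sigma>\<^sub>5(m)\<close> in the formula for \<open>MO 3 m\<close>.\<close>
    have A: "7 dvd A * int m + 3"
    proof -
      have "A * int m + 3 = 7 * (1960 * q ^ 3 + 1820 * q ^ 2 + 517 * q + 42)" if "r = 3"
        unfolding A_def m that by (simp add: algebra_simps power2_eq_square power3_eq_cube)
      moreover have "A * int m + 3 = 7 * (1960 * q ^ 3 + 3500 * q ^ 2 + 2037 * q + 384)" if "r = 5"
        unfolding A_def m that by (simp add: algebra_simps power2_eq_square power3_eq_cube)
      ultimately show ?thesis using r by (metis dvd_triv_left)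
    qed
    have "int m mod 7 \<in> {3, 5, 6}" using m r by auto
    note div = nonresidue_7_divisor_sums[OF this]
    have formula: "1920 * MO 3 m = (A * int m + 3) * divisor_sum 5 m
        - A * (int m * divisor_sum 5 m - divisor_sum 1 m) - 10 * (3 * int m - 5) * divisor_sum 3 m"
      unfolding MO_3_formula A_def by (simp add: algebra_simps)
    have "7 dvd 1920 * MO 3 m"
      unfolding formula
      by (rule dvd_diff[OF dvd_diff[OF dvd_mult2[OF A] dvd_mult[OF div(2)]] dvd_mult[OF div(1)]])
    \<comment> \<open>\<open>7 * 823 - 3 * 1920 = 1\<close> inverts 1920 modulo 7.\<close>
    then have "7 dvd 7 * (823 * MO 3 m) - 3 * (1920 * MO 3 m)"
      by (rule dvd_diff[OF dvd_triv_left dvd_mult])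
    moreover have "7 * (823 * MO 3 m) - 3 * (1920 * MO 3 m) = MO 3 m"
      by linarith
    ultimately show ?thesis
      by (simp only:)
  qed
  from this[of "7 * n + 3" "int n" 3] this[of "7 * n + 5" "int n" 5] show ?thesis by simp
qed

end
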